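(* Let $k$ be a field of characteristic zero. The Lie algebra of derivations of the $k$-algebra $W(2)$ is a solvable $2$-dimensional Lie algebra.
   Context: Let $E_2$ be a $2$-dimensional $k$-vector space with basis $v_1,v_2$. The algebra $W(2)$ is the $8$-dimensional vector space of all bilinear maps $E_2\times E_2\to E_2$, with the (nonassociative) multiplication $$(A\cdot B)(x,y)=A(v_1,B(x,y))-B(A(v_1,x),y)-B(x,A(v_1,y)),\qquad x,y\in E_2.$$ A derivation of an algebra $M$ is a $k$-linear map $D:M\to M$ with $D(ab)=D(a)b+aD(b)$ for all $a,b\in M$; derivations form a Lie algebra under the commutator. *)

theory Defs
  imports Complex_Main "HOL-Library.Function_Algebras"
begin

text \<open>
  An algebra is given by a carrier inside an ambient type, since the space of bilinear maps
  on an arbitrary two-dimensional space is a subspace of a function type and not a type.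
\<close>

definition fun_scale :: "('k \<Rightarrow> 'b \<Rightarrow> 'b) \<Rightarrow> 'k \<Rightarrow> ('a \<Rightarrow> 'b) \<Rightarrow> 'a \<Rightarrow> 'b" where
  "fun_scale scale c f = (\<lambda>x. scale c (f x))"

definition bilinear_maps ::
    "('k::field \<Rightarrow> 'e::ab_group_add \<Rightarrow> 'e) \<Rightarrow> ('e \<Rightarrow> 'e \<Rightarrow> 'e) set" where
  "bilinear_maps scale =
     {B. (\<forall>x. Vector_Spaces.linear scale scale (\<lambda>y. B x y)) \<and>
         (\<forall>y. Vector_Spaces.linear scale scale (\<lambda>x. B x y))}"

definition W_mult ::
    "'e::ab_group_add \<Rightarrow> ('e \<Rightarrow> 'e \<Rightarrow> 'e) \<Rightarrow> ('e \<Rightarrow> 'e \<Rightarrow> 'e) \<Rightarrow> 'e \<Rightarrow> 'e \<Rightarrow> 'e" where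
  "W_mult v A B = (\<lambda>x y. A v (B x y) - B (A v x) y - B x (A v y))"

text \<open>
  The last condition fixes the irrelevant values outside the carrier, so that every linear map
  from the carrier to itself is represented by exactly one function.
\<close>

definition derivations ::
    "('k::field \<Rightarrow> 'a::ab_group_add \<Rightarrow> 'a) \<Rightarrow> 'a set \<Rightarrow> ('a \<Rightarrow> 'a \<Rightarrow> 'a) \<Rightarrow> ('a \<Rightarrow> 'a) set" where
  "derivations scale M mult =
     {D. (\<forall>a\<in>M. D a \<in> M) \<and>
         (\<forall>a\<in>M. \<forall>b\<in>M. D (a + b) = D a + D b) \<and>
         (\<forall>c. \<forall>a\<in>M. D (scale c a) = scale c (D a)) \<and>
         (\<forall>a\<in>M. \<forall>b\<in>M. D (mult a b) = mult (D a) b + mult a (D b)) \<and>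
         (\<forall>a. a \<notin> M \<longrightarrow> D a = 0)}"

definition commutator :: "('a::ab_group_add \<Rightarrow> 'a) \<Rightarrow> ('a \<Rightarrow> 'a) \<Rightarrow> 'a \<Rightarrow> 'a" where
  "commutator D E = (\<lambda>a. D (E a) - E (D a))"

locale lie_algebra = vector_space scale
  for scale :: "'k::field \<Rightarrow> 'a::ab_group_add \<Rightarrow> 'a" +
  fixes L :: "'a set" and bracket :: "'a \<Rightarrow> 'a \<Rightarrow> 'a"
  assumes subspace_carrier: "subspace L"
    and bracket_closed: "x \<in> L \<Longrightarrow> y \<in> L \<Longrightarrow> bracket x y \<in> L"
    and bracket_add_left:
      "x \<in> L \<Longrightarrow> y \<in> L \<Longrightarrow> z \<in> L \<Longrightarrow> bracket (x + y) z = bracket x z + bracket y z"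
    and bracket_add_right:
      "x \<in> L \<Longrightarrow> y \<in> L \<Longrightarrow> z \<in> L \<Longrightarrow> bracket x (y + z) = bracket x y + bracket x z"
    and bracket_scale_left:
      "x \<in> L \<Longrightarrow> y \<in> L \<Longrightarrow> bracket (scale c x) y = scale c (bracket x y)"
    and bracket_scale_right:
      "x \<in> L \<Longrightarrow> y \<in> L \<Longrightarrow> bracket x (scale c y) = scale c (bracket x y)"
    and bracket_self: "x \<in> L \<Longrightarrow> bracket x x = 0"
    and jacobi: "x \<in> L \<Longrightarrow> y \<in> L \<Longrightarrow> z \<in> L \<Longrightarrow>
      bracket x (bracket y z) + bracket y (bracket z x) + bracket z (bracket x y) = 0"
begin

primrec derived_series :: "nat \<Rightarrow> 'a set" where
  "derived_series 0 = L"
| "derived_series (Suc n) =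
     span {bracket x y | x y. x \<in> derived_series n \<and> y \<in> derived_series n}"

definition solvable :: bool where
  "solvable \<longleftrightarrow> (\<exists>n. derived_series n = {0})"

end

end

theory Submission
  imports Defs
begin

text \<open>
  For an endomorphism \<open>g\<close> of the plane let \<open>act g\<close> be the natural action of \<open>gl(2)\<close> on bilinear
  maps. The multiplication is \<open>A \<cdot> B = act (A v1) B\<close>: multiplying by \<open>A\<close> on the left depends only
  on the slice \<open>A v1 \<in> gl(2)\<close>. Consequently the infinitesimal symmetries of the pair (plane,
  \<open>v1\<close>), that is the \<open>X \<in> gl(2)\<close> with \<open>X v1 = 0\<close>, act by derivations. In the basis \<open>v1, v2\<close> they
  are \<open>a E12 + b E22\<close>, and \<open>[E12, E22] = E12\<close>, so they form the two-dimensional nonabelian Lie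
  algebra, which is solvable. What has to be shown is that there are no other derivations.

  Let \<open>D\<close> be a derivation. Because \<open>gl(2)\<close> acts faithfully (\<open>act_faithful\<close>), the slice \<open>D A v1\<close>
  is a function \<open>\<delta>(A v1)\<close> of the slice \<open>A v1\<close>, and \<open>\<delta>\<close> is a derivation of \<open>gl(2)\<close>
  (\<open>induced_bracket\<close>). Evaluating \<open>D (act g B)\<close> at \<open>v1\<close> then determines every other slice of \<open>D B\<close>:
  \<open>D B (g v1) = \<delta>(B (g v1)) - B (\<delta>(g) v1)\<close>.
  Two consequences of this identity (\<open>D_other_slice\<close>) finish the proof. First, \<open>D A v1 v1\<close> depends
  only on \<open>A v1 v1\<close>, so that \<open>D A v1 v1 = X (A v1 v1)\<close> for an endomorphism \<open>X\<close>, and \<open>X v1 = 0\<close>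
  since \<open>\<delta>(1) = 0\<close>. Secondly, the difference \<open>D - act X\<close>, for which all values \<open>(\<dots>) A v1 v1\<close>
  vanish, has to be zero (\<open>D_eq_0\<close>).
\<close>

section \<open>Linear structure on functions and on derivations\<close>

lemma vector_space_fun_scale:
  assumes "vector_space scale"
  shows "vector_space (fun_scale scale)"
proof -
  interpret vector_space scale by (rule assms)
  show ?thesis
    by unfold_locales
      (auto simp: fun_scale_def fun_eq_iff scale_right_distrib scale_left_distrib)
qed

text \<open>Functions in \<open>derivations\<close> vanish off the carrier \<open>M\<close>. As \<open>0 \<in> M\<close> and \<open>D 0 = 0\<close>, the
  commutator vanishes there too, so the usual computation on \<open>M\<close> settles all values.\<close>

lemma derivations_lie_algebra:
  fixes scale :: "'k::field \<Rightarrow> 'a::ab_group_add \<Rightarrow> 'a"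
  assumes "vector_space scale"
    and sub: "module.subspace scale M"
    and closed: "\<And>a b. a \<in> M \<Longrightarrow> b \<in> M \<Longrightarrow> mult a b \<in> M"
    and add_left: "\<And>a b c. a \<in> M \<Longrightarrow> b \<in> M \<Longrightarrow> c \<in> M \<Longrightarrow> mult (a + b) c = mult a c + mult b c"
    and add_right: "\<And>a b c. a \<in> M \<Longrightarrow> b \<in> M \<Longrightarrow> c \<in> M \<Longrightarrow> mult a (b + c) = mult a b + mult a c"
    and scale_left: "\<And>t a b. a \<in> M \<Longrightarrow> b \<in> M \<Longrightarrow> mult (scale t a) b = scale t (mult a b)"
    and scale_right: "\<And>t a b. a \<in> M \<Longrightarrow> b \<in> M \<Longrightarrow> mult a (scale t b) = scale t (mult a b)"
  shows "lie_algebra (fun_scale scale) (derivations scale M mult) commutator"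
proof -
  interpret vector_space scale by (rule assms(1))
  interpret F: vector_space "fun_scale scale" by (rule vector_space_fun_scale[OF assms(1)])
  let ?Der = "derivations scale M mult"
  have M0: "0 \<in> M" using sub subspace_0 by blast
  have Mdiff: "a - b \<in> M" if "a \<in> M" "b \<in> M" for a b using sub that subspace_diff by blast
  have Madd: "a + b \<in> M" if "a \<in> M" "b \<in> M" for a b using sub that subspace_add by blast
  have Mscale: "scale t a \<in> M" if "a \<in> M" for a t using sub that subspace_scale by blast
  have mult_diff: "mult (a - b) c = mult a c - mult b c" "mult c (a - b) = mult c a - mult c b"
    if "a \<in> M" "b \<in> M" "c \<in> M" for a b c
    using add_left[of "a - b" b c] add_right[of c "a - b" b] that Mdiff by auto
  have D0: "D 0 = 0" if "D \<in> ?Der" for D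
  proof -
    have "D (scale 0 0) = scale 0 (D 0)" using that M0 unfolding derivations_def by blast
    then show ?thesis by simp
  qed
  have Ddiff: "D (a - b) = D a - D b" if "D \<in> ?Der" "a \<in> M" "b \<in> M" for D a b
  proof -
    have "D ((a - b) + b) = D (a - b) + D b"
      using that Mdiff unfolding derivations_def by blast
    then show ?thesis by simp
  qed
  have DM: "D a \<in> M" if "D \<in> ?Der" for D a
    using that M0 unfolding derivations_def by (cases "a \<in> M") auto
  have Dadd: "D (a + b) = D a + D b" if "D \<in> ?Der" "a \<in> M" "b \<in> M" for D a b
    using that unfolding derivations_def by blast
  have Dscale: "D (scale t a) = scale t (D a)" if "D \<in> ?Der" "a \<in> M" for D a t
    using that unfolding derivations_def by blast
  have Dmult: "D (mult a b) = mult (D a) b + mult a (D b)" if "D \<in> ?Der" "a \<in> M" "b \<in> M" for D a b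
    using that unfolding derivations_def by blast
  have Dout: "D a = 0" if "D \<in> ?Der" "a \<notin> M" for D a
    using that unfolding derivations_def by blast
  have "F.subspace ?Der"
  proof (rule F.subspaceI)
    show "0 \<in> ?Der"
      using M0 mult_diff[of 0 0] by (auto simp: derivations_def)
  next
    fix D E assume D: "D \<in> ?Der" and E: "E \<in> ?Der"
    show "D + E \<in> ?Der"
      unfolding derivations_def
      by (auto simp: D E DM Madd Dadd Dscale Dmult Dout add_left add_right scale_right_distrib)
  next
    fix t D assume D: "D \<in> ?Der"
    show "fun_scale scale t D \<in> ?Der"
      unfolding derivations_def fun_scale_def
      by (auto simp: D DM Mscale Dadd Dscale Dmult Dout scale_left scale_right
          scale_right_distrib mult.commute)
  qed
  moreover have "commutator D E \<in> ?Der" if D: "D \<in> ?Der" and E: "E \<in> ?Der" for D E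
    unfolding derivations_def commutator_def
    by (auto simp: D E DM Mdiff Madd closed Dadd Dscale Dmult Dout D0 mult_diff
        scale_right_diff_distrib)
  ultimately show ?thesis
    by unfold_locales
      (auto simp: commutator_def fun_scale_def fun_eq_iff DM Ddiff Dadd Dscale
        scale_right_diff_distrib)
qed

section \<open>Coordinates on the plane and the action of its endomorphisms\<close>

text \<open>The coordinate functionals are parameters, so that rank one endomorphisms and bilinear maps
  can be written down explicitly; \<open>plane_of_basis\<close> provides them for every basis.\<close>

locale plane = vector_space scale
  for scale :: "'k::field_char_0 \<Rightarrow> 'e::ab_group_add \<Rightarrow> 'e" (infixr "*s" 75) +
  fixes v1 v2 :: 'e and c1 c2 :: "'e \<Rightarrow> 'k"
  assumes c1_add: "c1 (x + y) = c1 x + c1 y" and c1_scale: "c1 (t *s x) = t * c1 x"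
    and c2_add: "c2 (x + y) = c2 x + c2 y" and c2_scale: "c2 (t *s x) = t * c2 x"
    and c1_v1: "c1 v1 = 1" and c1_v2: "c1 v2 = 0"
    and c2_v1: "c2 v1 = 0" and c2_v2: "c2 v2 = 1"
    and decompose: "c1 x *s v1 + c2 x *s v2 = x"
begin

abbreviation endo :: "('e \<Rightarrow> 'e) \<Rightarrow> bool" where
  "endo g \<equiv> Vector_Spaces.linear scale scale g"

abbreviation W :: "('e \<Rightarrow> 'e \<Rightarrow> 'e) set" where
  "W \<equiv> bilinear_maps scale"

definition act :: "('e \<Rightarrow> 'e) \<Rightarrow> ('e \<Rightarrow> 'e \<Rightarrow> 'e) \<Rightarrow> 'e \<Rightarrow> 'e \<Rightarrow> 'e" where
  "act g B = (\<lambda>x y. g (B x y) - B (g x) y - B x (g y))"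

lemma W_mult_eq_act: "W_mult v1 A B = act (A v1) B"
  by (simp add: W_mult_def act_def)

lemma endo_iff: "endo g \<longleftrightarrow> (\<forall>x y. g (x + y) = g x + g y) \<and> (\<forall>t x. g (t *s x) = t *s g x)"
  by (simp add: Vector_Spaces.linear_iff vector_space_axioms)

lemma endo_add: "endo g \<Longrightarrow> g (x + y) = g x + g y"
  and endo_scale: "endo g \<Longrightarrow> g (t *s x) = t *s g x"
  by (auto simp: endo_iff)

lemma endo_zero: "endo g \<Longrightarrow> g 0 = 0"
  using endo_scale[of g 0 0] by simp

lemma endo_diff: "endo g \<Longrightarrow> g (x - y) = g x - g y"
  using endo_add[of g "x - y" y] by simp

lemma coordinates_zero: "c1 0 = 0" "c2 0 = 0"
  using c1_scale[of 0 0] c2_scale[of 0 0] by auto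

lemma coordinates_eqI: "c1 x = c1 y \<Longrightarrow> c2 x = c2 y \<Longrightarrow> x = y"
  by (metis decompose)

lemma endo_eqI:
  assumes "endo g" "endo h" "g v1 = h v1" "g v2 = h v2"
  shows "g = h"
proof
  fix x
  have "g (c1 x *s v1 + c2 x *s v2) = h (c1 x *s v1 + c2 x *s v2)"
    by (simp add: endo_add endo_scale assms)
  then show "g x = h x" by (simp add: decompose)
qed

lemma in_W_iff: "B \<in> W \<longleftrightarrow> (\<forall>x. endo (B x)) \<and> (\<forall>y. endo (\<lambda>x. B x y))"
  by (simp add: bilinear_maps_def)

lemma slice_endo: "B \<in> W \<Longrightarrow> endo (B x)"
  by (simp add: in_W_iff)

lemma W_add_left: "B \<in> W \<Longrightarrow> B (x + x') y = B x y + B x' y"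
  and W_scale_left: "B \<in> W \<Longrightarrow> B (t *s x) y = t *s B x y"
  and W_add_right: "B \<in> W \<Longrightarrow> B x (y + y') = B x y + B x y'"
  and W_scale_right: "B \<in> W \<Longrightarrow> B x (t *s y) = t *s B x y"
  by (simp_all add: in_W_iff endo_iff)

lemma W_zero: "B \<in> W \<Longrightarrow> B 0 y = 0" "B \<in> W \<Longrightarrow> B x 0 = 0"
  using W_scale_left[of B 0 0] W_scale_right[of B x 0 0] by auto

lemma W_diff: "B \<in> W \<Longrightarrow> B (x - x') y = B x y - B x' y"
  "B \<in> W \<Longrightarrow> B x (y - y') = B x y - B x y'"
  by (metis W_add_left add_diff_cancel_right' diff_add_cancel)
     (metis W_add_right add_diff_cancel_right' diff_add_cancel)

lemmas W_simps = W_add_left W_scale_left W_add_right W_scale_right W_diff W_zero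

lemma W_diff_closed: "A \<in> W \<Longrightarrow> B \<in> W \<Longrightarrow> A - B \<in> W"
  by (auto simp: in_W_iff endo_iff algebra_simps)

lemma W_subspace: "module.subspace (fun_scale (fun_scale scale)) W"
proof -
  interpret V: vector_space "fun_scale (fun_scale scale)"
    by (intro vector_space_fun_scale vector_space_axioms)
  show ?thesis
    by (rule V.subspaceI)
      (auto simp: in_W_iff endo_iff fun_scale_def algebra_simps mult.commute)
qed

lemma act_in_W: "endo g \<Longrightarrow> B \<in> W \<Longrightarrow> act g B \<in> W"
  unfolding in_W_iff[of "act g B"] endo_iff[of "act g B _"] endo_iff[of "\<lambda>x. act g B x _"]
  by (simp add: act_def W_simps endo_add endo_scale scale_right_diff_distrib)

lemma W_mult_lie_algebra:
  "lie_algebra (fun_scale (fun_scale (fun_scale scale)))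
     (derivations (fun_scale (fun_scale scale)) W (W_mult v1)) commutator"
proof (rule derivations_lie_algebra)
  show "vector_space (fun_scale (fun_scale scale))"
    by (intro vector_space_fun_scale vector_space_axioms)
  show "module.subspace (fun_scale (fun_scale scale)) W"
    by (rule W_subspace)
  show "W_mult v1 A B \<in> W" if "A \<in> W" "B \<in> W" for A B
    using that by (simp add: W_mult_eq_act act_in_W slice_endo)
qed (auto simp: W_mult_def fun_scale_def fun_eq_iff W_simps scale_right_diff_distrib)

text \<open>Bilinear maps \<open>\<alpha> \<otimes> id\<close> suffice: \<open>g\<close> sends such a map to \<open>-(\<alpha> \<circ> g) \<otimes> id\<close>, and
  the functionals \<open>\<alpha>\<close> separate points.\<close>

lemma act_faithful:
  assumes g: "endo g" and "\<And>B. B \<in> W \<Longrightarrow> act g B = 0"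
  shows "g = 0"
proof
  fix x
  have W1: "(\<lambda>x y. c1 x *s y) \<in> W" and W2: "(\<lambda>x y. c2 x *s y) \<in> W"
    by (auto simp: in_W_iff endo_iff c1_add c1_scale c2_add c2_scale algebra_simps)
  have "act g (\<lambda>x y. c1 x *s y) x v1 = 0" "act g (\<lambda>x y. c2 x *s y) x v1 = 0"
    using assms(2)[OF W1] assms(2)[OF W2] by simp_all
  then have "c1 (g x) *s v1 = 0" "c2 (g x) *s v1 = 0"
    by (simp_all add: act_def endo_scale[OF g])
  moreover have "v1 \<noteq> 0" using c1_v1 coordinates_zero by auto
  ultimately show "g x = 0 x"
    using decompose[of "g x"] by simp
qed

section \<open>Derivations coming from endomorphisms that kill the base vector\<close>

abbreviation Der :: "(('e \<Rightarrow> 'e \<Rightarrow> 'e) \<Rightarrow> 'e \<Rightarrow> 'e \<Rightarrow> 'e) set" where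
  "Der \<equiv> derivations (fun_scale (fun_scale scale)) W (W_mult v1)"

definition act_der :: "('e \<Rightarrow> 'e) \<Rightarrow> ('e \<Rightarrow> 'e \<Rightarrow> 'e) \<Rightarrow> 'e \<Rightarrow> 'e \<Rightarrow> 'e" where
  "act_der X = (\<lambda>B. if B \<in> W then act X B else 0)"

text \<open>Being built from \<open>v1\<close> and evaluation alone, the multiplication is \<open>gl(2)\<close>-equivariant up to
  a term in \<open>X v1\<close>: with \<open>X v1 = 0\<close> the slice of \<open>act X A\<close> at \<open>v1\<close> is \<open>[X, A v1]\<close>.\<close>

lemma act_der_in_Der:
  assumes X: "endo X" and "X v1 = 0"
  shows "act_der X \<in> Der"
proof -
  have sub: "A + B \<in> W" "fun_scale (fun_scale scale) t A \<in> W" if "A \<in> W" "B \<in> W" for A B t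
    using that by (auto simp: in_W_iff endo_iff fun_scale_def algebra_simps mult.commute)
  have "W_mult v1 A B \<in> W" if "A \<in> W" "B \<in> W" for A B
    using that by (simp add: W_mult_eq_act act_in_W slice_endo)
  then show ?thesis
    unfolding derivations_def act_der_def
    by (auto simp: sub act_in_W X)
      (auto simp: act_def W_mult_def fun_scale_def fun_eq_iff assms W_simps
        endo_add endo_diff endo_scale scale_right_diff_distrib)
qed

lemma act_der_inj:
  assumes "endo X" "endo Y" "act_der X = act_der Y"
  shows "X = Y"
proof -
  have "act (X - Y) B = 0" if "B \<in> W" for B
  proof -
    have "act X B = act Y B" using fun_cong[OF assms(3), of B] that by (simp add: act_der_def)
    then show ?thesis using that by (auto simp: act_def fun_eq_iff W_simps algebra_simps)
  qed
  moreover have "endo (X - Y)"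
    using assms by (auto simp: endo_iff algebra_simps)
  ultimately have "X - Y = 0" by (rule act_faithful[rotated])
  then show ?thesis by simp
qed

lemma commutator_act_der:
  assumes "endo X" "endo Y"
  shows "commutator (act_der X) (act_der Y) = act_der (\<lambda>x. X (Y x) - Y (X x))"
  using assms
  by (auto simp: commutator_def act_der_def act_in_W fun_eq_iff)
    (auto simp: act_def W_simps endo_diff endo_zero)

section \<open>Every derivation comes from an endomorphism\<close>

text \<open>A linear section of \<open>A \<mapsto> A v1\<close>: it realises each endomorphism as the slice of an element
  of the algebra.\<close>

definition lift :: "('e \<Rightarrow> 'e) \<Rightarrow> 'e \<Rightarrow> 'e \<Rightarrow> 'e" where
  "lift g = (\<lambda>x y. c1 x *s g y)"

lemma lift_in_W: "endo g \<Longrightarrow> lift g \<in> W"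
  by (auto simp: lift_def in_W_iff endo_iff c1_add c1_scale algebra_simps)

lemma lift_v1: "lift g v1 = g"
  by (simp add: lift_def c1_v1)

end

locale W_derivation = plane scale v1 v2 c1 c2
  for scale :: "'k::field_char_0 \<Rightarrow> 'e::ab_group_add \<Rightarrow> 'e" (infixr "*s" 75)
    and v1 v2 :: 'e and c1 c2 :: "'e \<Rightarrow> 'k" +
  fixes D :: "('e \<Rightarrow> 'e \<Rightarrow> 'e) \<Rightarrow> 'e \<Rightarrow> 'e \<Rightarrow> 'e"
  assumes D_in_Der: "D \<in> Der"
begin

text \<open>The derivation \<open>\<delta>\<close> of \<open>gl(2)\<close> that \<open>D\<close> induces on slices.\<close>

definition induced :: "('e \<Rightarrow> 'e) \<Rightarrow> 'e \<Rightarrow> 'e" where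
  "induced g = D (lift g) v1"

lemma D_in_W: "A \<in> W \<Longrightarrow> D A \<in> W"
  and D_add: "A \<in> W \<Longrightarrow> B \<in> W \<Longrightarrow> D (A + B) = D A + D B"
  and D_scale: "A \<in> W \<Longrightarrow> D (\<lambda>x y. t *s A x y) = (\<lambda>x y. t *s D A x y)"
  and D_act: "A \<in> W \<Longrightarrow> B \<in> W \<Longrightarrow> D (act (A v1) B) = act (D A v1) B + act (A v1) (D B)"
  and D_outside: "A \<notin> W \<Longrightarrow> D A = 0"
  using D_in_Der unfolding derivations_def fun_scale_def W_mult_eq_act by blast+

lemma D_diff: "A \<in> W \<Longrightarrow> B \<in> W \<Longrightarrow> D (A - B) = D A - D B"
  using D_add[of "A - B" B] W_diff_closed by simp

text \<open>If \<open>A v1 = 0\<close>, left multiplication by \<open>A\<close> is zero. The derivation rule makes left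
  multiplication by \<open>D A\<close> zero as well, and faithfulness applies.\<close>

lemma D_v1_eq_0:
  assumes A: "A \<in> W" and "A v1 = 0"
  shows "D A v1 = 0"
proof (rule act_faithful)
  show "endo (D A v1)" using A D_in_W slice_endo by blast
  fix B assume B: "B \<in> W"
  have a0: "act 0 C = 0" if "C \<in> W" for C
    using that by (auto simp: act_def fun_eq_iff W_simps)
  have "(0 :: 'e \<Rightarrow> 'e \<Rightarrow> 'e) \<in> W" by (simp add: in_W_iff endo_iff)
  then have "D 0 = 0" using D_diff[of 0 0] by simp
  then show "act (D A v1) B = 0"
    using D_act[OF A B] a0[OF B] a0[OF D_in_W[OF B]] by (simp add: assms)
qed

lemma D_v1:
  assumes A: "A \<in> W"
  shows "D A v1 = induced (A v1)"
proof -
  have T: "lift (A v1) \<in> W" using A by (simp add: lift_in_W slice_endo)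
  have "D (A - lift (A v1)) v1 = 0"
    by (rule D_v1_eq_0) (simp_all add: W_diff_closed A T lift_v1)
  then show ?thesis by (simp add: D_diff A T induced_def)
qed

lemma induced_endo: "endo g \<Longrightarrow> endo (induced g)"
  by (simp add: induced_def slice_endo D_in_W lift_in_W)

lemma D_act_endo:
  assumes g: "endo g" and B: "B \<in> W"
  shows "D (act g B) = act (induced g) B + act g (D B)"
  using D_act[OF lift_in_W[OF g] B] by (simp add: lift_v1 induced_def)

text \<open>The identity acts as \<open>1 - 1 - 1 = -1\<close>, which commutes with \<open>D\<close>.\<close>

lemma induced_id: "induced (\<lambda>x. x) = 0"
proof (rule act_faithful)
  have id: "endo (\<lambda>x. x)" by (simp add: endo_iff)
  show "endo (induced (\<lambda>x. x))" by (rule induced_endo[OF id])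
  fix B assume B: "B \<in> W"
  have m: "act (\<lambda>x. x) C = (\<lambda>x y. (- 1) *s C x y)" for C
    by (simp add: act_def)
  show "act (induced (\<lambda>x. x)) B = 0"
    using D_act_endo[OF id B] D_scale[OF B] by (simp only: m) (simp add: fun_eq_iff)
qed

lemma induced_diff:
  assumes "endo g" "endo h"
  shows "induced (\<lambda>x. g x - h x) = (\<lambda>x. induced g x - induced h x)"
proof -
  have "lift (\<lambda>x. g x - h x) = lift g - lift h"
    by (simp add: lift_def fun_eq_iff scale_right_diff_distrib)
  then show ?thesis unfolding induced_def using assms by (simp add: D_diff lift_in_W) auto
qed

lemma act_bracket:
  assumes "endo g" "endo h" "B \<in> W"
  shows "act (\<lambda>x. g (h x) - h (g x)) B = act g (act h B) - act h (act g B)"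
  using assms by (auto simp: act_def fun_eq_iff W_simps endo_diff)

lemma bracket_endo: "endo g \<Longrightarrow> endo h \<Longrightarrow> endo (\<lambda>x. g (h x) - h (g x))"
  by (simp add: endo_iff algebra_simps)

text \<open>On bilinear maps \<open>act (\<delta> g)\<close> is the commutator of \<open>D\<close> with \<open>act g\<close>. Taking commutators with \<open>D\<close> is a
  derivation on operators, and faithfulness carries the rule back to \<open>gl(2)\<close>.\<close>

lemma induced_bracket:
  assumes g: "endo g" and h: "endo h"
  shows "induced (\<lambda>x. g (h x) - h (g x)) =
    (\<lambda>x. induced g (h x) - h (induced g x) + (g (induced h x) - induced h (g x)))"
    (is "induced ?b = ?r")
proof -
  note sg = induced_endo[OF g] and sh = induced_endo[OF h]
  have b: "endo ?b" by (rule bracket_endo[OF g h])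
  have r: "endo ?r" using g h sg sh by (simp add: endo_iff algebra_simps)
  have "induced ?b - ?r = 0"
  proof (rule act_faithful)
    show "endo (induced ?b - ?r)"
      using induced_endo[OF b] r by (simp add: endo_iff algebra_simps)
    fix B assume B: "B \<in> W"
    have "D (act ?b B) = D (act g (act h B)) - D (act h (act g B))"
      by (simp add: act_bracket g h B D_diff act_in_W)
    also have "\<dots> = act (induced g) (act h B) + act g (act (induced h) B) + act g (act h (D B))
       - (act (induced h) (act g B) + act h (act (induced g) B) + act h (act g (D B)))"
      by (simp add: D_act_endo act_in_W g h B sg sh D_in_W fun_eq_iff)
         (simp add: act_def g h endo_add)
    also have "\<dots> = act ?r B + act ?b (D B)"
      using g h sg sh B D_in_W[OF B]
      by (auto simp: act_def fun_eq_iff W_simps endo_diff endo_add)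
    finally have "act (induced ?b) B = act ?r B"
      using D_act_endo[OF b B] by simp
    then show "act (induced ?b - ?r) B = 0"
      using B by (auto simp: act_def fun_eq_iff W_simps algebra_simps)
  qed
  then show ?thesis by simp
qed

text \<open>The slice of \<open>act g B\<close> at \<open>v1\<close> is \<open>[g, B v1] - B (g v1)\<close>, so the action of \<open>g\<close> moves the
  slice at \<open>g v1\<close> to the slice at \<open>v1\<close>, where \<open>D\<close> is known. The bracket terms cancel by
  \<open>induced_bracket\<close>.\<close>

lemma D_other_slice:
  assumes g: "endo g" and B: "B \<in> W"
  shows "D B (g v1) = (\<lambda>y. induced (B (g v1)) y - B (induced g v1) y)"
proof -
  let ?b = "\<lambda>x. g (B v1 x) - B v1 (g x)"
  note s = slice_endo[OF B]
  have b: "endo ?b" by (rule bracket_endo[OF g s])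
  have "D (act g B) v1 = induced (act g B v1)"
    by (rule D_v1[OF act_in_W[OF g B]])
  also have "act g B v1 = (\<lambda>y. ?b y - B (g v1) y)"
    by (auto simp: act_def)
  finally have "induced ?b y - induced (B (g v1)) y = act (induced g) B v1 y + act g (D B) v1 y" for y
    by (simp add: induced_diff[OF b s] D_act_endo[OF g B] fun_eq_iff)
  then show ?thesis
    by (simp add: induced_bracket[OF g s] fun_eq_iff act_def D_v1[OF B] algebra_simps)
qed

text \<open>Taking \<open>g = A v1\<close> in \<open>D_other_slice\<close> leaves \<open>B (D A v1 v1) = 0\<close> for every \<open>B\<close>, and bilinear
  maps separate points.\<close>

lemma D_v1_v1_eq_0:
  assumes A: "A \<in> W" and z: "A v1 v1 = 0"
  shows "D A v1 v1 = 0"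
proof -
  let ?w = "D A v1 v1"
  have "B ?w y = 0" if B: "B \<in> W" for B y
  proof -
    have "induced (B 0) y = D B 0 y + B ?w y"
      using D_other_slice[OF slice_endo[OF A] B, of v1] by (simp add: z D_v1[OF A])
    moreover have "B 0 = 0" using B by (simp add: fun_eq_iff W_simps)
    moreover have "induced 0 = 0"
      using induced_diff[of id id] by (simp add: endo_iff zero_fun_def)
    ultimately show ?thesis using D_in_W[OF B] by (simp add: W_simps)
  qed
  from this[of "\<lambda>x y. c1 x *s y" v1] this[of "\<lambda>x y. c2 x *s y" v1]
  have "c1 ?w *s v1 = 0" "c2 ?w *s v1 = 0"
    by (auto simp: in_W_iff endo_iff c1_add c1_scale c2_add c2_scale algebra_simps)
  then show ?thesis
    using decompose[of ?w] c1_v1 coordinates_zero by auto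
qed

text \<open>Now \<open>\<delta>(g) v1 = 0\<close> for all \<open>g\<close>, and \<open>D_other_slice\<close> reduces the claim to \<open>\<delta> = 0\<close>. Evaluating
  \<open>\<delta>[g, h]\<close> at \<open>v1\<close> gives the symmetry \<open>\<delta>(g) (h v1) = \<delta>(h) (g v1)\<close>. With \<open>h = E21\<close>, where
  \<open>h v1 = v2\<close>, everything comes down to \<open>\<delta>(E21) = 0\<close>, and this follows from \<open>[E22, E21] = E21\<close>.\<close>

lemma D_eq_0:
  assumes v: "\<And>A. A \<in> W \<Longrightarrow> D A v1 v1 = 0"
  shows "D = 0"
proof -
  have sv: "induced g v1 = 0" if "endo g" for g
    using v[OF lift_in_W[OF that]] by (simp add: induced_def)
  have swap: "induced g (h v1) = induced h (g v1)" if g: "endo g" and h: "endo h" for g h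
    using fun_cong[OF induced_bracket[OF g h], of v1] sv[OF g] sv[OF h]
      sv[OF bracket_endo[OF g h]]
    by (simp add: endo_zero g h)
  let ?E22 = "\<lambda>x. c2 x *s v2" and ?E21 = "\<lambda>x. c1 x *s v2"
  have q: "endo ?E22" and r: "endo ?E21"
    by (auto simp: endo_iff c1_add c1_scale c2_add c2_scale algebra_simps)
  have rank1: "endo (\<lambda>x. c1 x *s u)" for u
    by (auto simp: endo_iff c1_add c1_scale algebra_simps)
  have sq: "induced ?E22 u = 0" for u
    using swap[OF q rank1[of u]] endo_zero[OF induced_endo[OF rank1[of u]]]
    by (simp add: c1_v1 c2_v1)
  \<comment> \<open>With \<open>z = \<delta>(E21) v2\<close> the bracket relation reads \<open>2 z = E22 z\<close>, while the eigenvalues of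
      \<open>E22\<close> are only \<open>0\<close> and \<open>1\<close>.\<close>
  have "induced ?E21 v2 = 0"
  proof (rule coordinates_eqI)
    have "(\<lambda>x. ?E22 (?E21 x) - ?E21 (?E22 x)) = ?E21"
      by (simp add: fun_eq_iff c1_v2 c2_v2 c1_scale c2_scale)
    then have e: "induced ?E21 v2 = c2 (induced ?E21 v2) *s v2 - induced ?E21 v2"
      using fun_cong[OF induced_bracket[OF q r], of v2] by (simp add: sq c2_v2 coordinates_zero)
    then have e': "induced ?E21 v2 + induced ?E21 v2 = c2 (induced ?E21 v2) *s v2"
      by (metis diff_add_cancel)
    show "c1 (induced ?E21 v2) = c1 0"
      using arg_cong[OF e', of c1] by (simp add: c1_add c1_scale c1_v2 coordinates_zero)
    show "c2 (induced ?E21 v2) = c2 0"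
      using arg_cong[OF e', of c2] by (simp add: c2_add c2_scale c2_v2 coordinates_zero)
  qed
  then have sr: "induced ?E21 = 0"
    by (intro endo_eqI induced_endo[OF r]) (simp_all add: sv[OF r], simp add: endo_iff)
  have s0: "induced g = 0" if g: "endo g" for g
    using swap[OF g r]
    by (intro endo_eqI induced_endo[OF g]) (simp_all add: sv[OF g] sr c1_v1, simp add: endo_iff)
  show ?thesis
  proof
    fix B show "D B = 0 B"
    proof (cases "B \<in> W")
      case True
      have "D B u y = 0" for u y
        using fun_cong[OF D_other_slice[OF rank1[of u] True], of y]
        by (simp add: c1_v1 s0 slice_endo True rank1 W_simps)
      then show ?thesis by (simp add: fun_eq_iff)
    qed (simp add: D_outside)
  qed
qed

end

context plane
begin

lemma Der_eq_act_der:
  assumes D: "D \<in> Der"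
  shows "\<exists>X. endo X \<and> X v1 = 0 \<and> D = act_der X"
proof -
  interpret D: W_derivation scale v1 v2 c1 c2 D by unfold_locales (rule D)
  \<comment> \<open>A bilinear map with value \<open>u\<close> at \<open>(v1, v1)\<close>, chosen linear in \<open>u\<close>.\<close>
  let ?Q = "\<lambda>u x y. c1 x *s c1 y *s u"
  define X where "X u = D (?Q u) v1 v1" for u
  have Q: "?Q u \<in> W" for u
    by (auto simp: in_W_iff endo_iff c1_add c1_scale algebra_simps)
  have DX: "D A v1 v1 = X (A v1 v1)" if A: "A \<in> W" for A
  proof -
    have "D (A - ?Q (A v1 v1)) v1 v1 = 0"
      by (rule D.D_v1_v1_eq_0) (simp_all only: W_diff_closed A Q, simp add: c1_v1)
    then show ?thesis unfolding D.D_diff[OF A Q] X_def by simp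
  qed
  have X: "endo X"
    unfolding endo_iff
  proof (intro conjI allI)
    fix x y t
    have "?Q (x + y) = ?Q x + ?Q y" by (simp add: fun_eq_iff algebra_simps)
    then show "X (x + y) = X x + X y" unfolding X_def using D.D_add[OF Q Q, of x y] by simp
    have "?Q (t *s x) = (\<lambda>u w. t *s ?Q x u w)" by (simp add: fun_eq_iff algebra_simps)
    then show "X (t *s x) = t *s X x" unfolding X_def using D.D_scale[OF Q, of t x] by simp
  qed
  \<comment> \<open>The lift of the identity has value \<open>v1\<close> at \<open>(v1, v1)\<close>, and \<open>\<delta>\<close> kills the identity.\<close>
  have Xv: "X v1 = 0"
  proof -
    have "endo (\<lambda>x. x)" by (simp add: endo_iff)
    from DX[OF lift_in_W[OF this]] show ?thesis
      using D.induced_id by (simp add: lift_v1 D.induced_def)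
  qed
  interpret L: lie_algebra "fun_scale (fun_scale (fun_scale scale))" Der commutator
    by (rule W_mult_lie_algebra)
  have "D - act_der X \<in> Der"
    by (rule L.subspace_diff[OF L.subspace_carrier D act_der_in_Der[OF X Xv]])
  then interpret E: W_derivation scale v1 v2 c1 c2 "D - act_der X" by unfold_locales
  have "D - act_der X = 0"
    by (rule E.D_eq_0) (simp add: act_der_def act_def DX Xv W_simps)
  then show ?thesis using X Xv by auto
qed

section \<open>Dimension and solvability\<close>

abbreviation E12 :: "'e \<Rightarrow> 'e" where "E12 \<equiv> \<lambda>x. c2 x *s v1"
abbreviation E22 :: "'e \<Rightarrow> 'e" where "E22 \<equiv> \<lambda>x. c2 x *s v2"

lemma endo_E: "endo E12" "endo E22"
  by (auto simp: endo_iff c2_add c2_scale algebra_simps)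

abbreviation scaleD where "scaleD \<equiv> fun_scale (fun_scale (fun_scale scale))"

lemma act_der_combination:
  assumes X: "endo X" and "X v1 = 0"
  shows "act_der X = scaleD (c1 (X v2)) (act_der E12) + scaleD (c2 (X v2)) (act_der E22)"
proof -
  have "X = (\<lambda>x. c1 (X v2) *s E12 x + c2 (X v2) *s E22 x)"
    by (rule endo_eqI[OF X])
      (auto simp: endo_iff c2_add c2_scale algebra_simps assms c2_v1 c2_v2 decompose)
  then have "act X B = act (\<lambda>x. c1 (X v2) *s E12 x + c2 (X v2) *s E22 x) B" for B
    by simp
  then show ?thesis
    by (auto simp: act_der_def fun_scale_def fun_eq_iff)
      (simp add: act_def W_simps algebra_simps)
qed

text \<open>Endomorphisms killing \<open>v1\<close> induce scalars on the quotient by the line of \<open>v1\<close>. Scalars commute,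
  so a commutator maps \<open>v2\<close> into that line.\<close>

lemma commutator_in_line:
  assumes "D \<in> Der" "E \<in> Der"
  shows "\<exists>t. commutator D E = scaleD t (act_der E12)"
proof -
  obtain X Y where X: "endo X" "X v1 = 0" "D = act_der X" and Y: "endo Y" "Y v1 = 0" "E = act_der Y"
    using assms Der_eq_act_der by metis
  let ?Z = "\<lambda>x. X (Y x) - Y (X x)"
  have Z: "endo ?Z" using X Y by (simp add: endo_iff algebra_simps)
  have Z1: "?Z v1 = 0" using X Y by (simp add: endo_zero)
  have on_plane: "g u = c2 u *s g v2" if "endo g" "g v1 = 0" for g u
    using arg_cong[OF decompose[of u], of g] that by (simp add: endo_add endo_scale)
  have "?Z v2 = c2 (Y v2) *s X v2 - c2 (X v2) *s Y v2"
    using on_plane[OF X(1,2), of "Y v2"] on_plane[OF Y(1,2), of "X v2"] by simp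
  then have "c2 (?Z v2) + c2 (c2 (X v2) *s Y v2) = c2 (c2 (Y v2) *s X v2)"
    by (metis c2_add diff_add_cancel)
  then have "c2 (?Z v2) = 0" by (simp add: c2_scale)
  then have "act_der ?Z = scaleD (c1 (?Z v2)) (act_der E12)"
    using act_der_combination[OF Z Z1] by (simp add: fun_scale_def fun_eq_iff)
  then show ?thesis using X Y by (auto simp: commutator_act_der)
qed

lemma Der_dim_solvable:
  "lie_algebra scaleD Der commutator \<and> vector_space.dim scaleD Der = 2
    \<and> lie_algebra.solvable scaleD Der commutator"
proof -
  interpret L: lie_algebra scaleD Der commutator
    by (rule W_mult_lie_algebra)
  let ?N = "act_der E12" and ?P = "act_der E22"
  have N: "?N \<in> Der" and P: "?P \<in> Der"
    by (simp_all add: act_der_in_Der endo_E c2_v1)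
  have scale_P: "scaleD t ?P = act_der (\<lambda>x. t *s E22 x)" for t
    by (auto simp: fun_scale_def act_der_def act_def fun_eq_iff W_simps algebra_simps)
  have N_indep: "?N \<noteq> scaleD t ?P" for t
  proof
    assume "?N = scaleD t ?P"
    then have "E12 = (\<lambda>x. t *s E22 x)"
      unfolding scale_P
      by (intro act_der_inj) (auto simp: endo_iff c2_add c2_scale algebra_simps)
    from fun_cong[OF this, of v2] have "c1 v1 = c1 (t *s v2)" by (simp add: c2_v2)
    then show False by (simp add: c1_v1 c1_scale c1_v2)
  qed
  have P0: "?P \<noteq> 0"
  proof
    assume "?P = 0"
    then have "act_der E22 = act_der 0"
      by (auto simp: act_der_def fun_eq_iff act_def W_simps)
    then have "E22 = 0"
      by (intro act_der_inj endo_E) (simp_all add: endo_iff)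
    from fun_cong[OF this, of v2] have "c2 v2 = c2 0" by (simp add: c2_v2)
    then show False by (simp add: c2_v2 coordinates_zero)
  qed
  have "L.dim Der = 2"
  proof (rule L.dim_unique[of "{?N, ?P}"])
    show "{?N, ?P} \<subseteq> Der" using N P by simp
    show "Der \<subseteq> L.span {?N, ?P}"
    proof
      fix D assume "D \<in> Der"
      then obtain X where "endo X" "X v1 = 0" "D = act_der X" using Der_eq_act_der by blast
      then show "D \<in> L.span {?N, ?P}"
        by (simp add: act_der_combination L.span_add L.span_scale L.span_base)
    qed
    show "L.independent {?N, ?P}"
      using N_indep P0 by (auto simp: L.independent_insert L.span_singleton)
    show "card {?N, ?P} = 2" using N_indep[of 1] by auto
  qed
  moreover have "L.solvable"
  proof -
    have "L.derived_series 1 \<subseteq> L.span {?N}"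
    proof -
      have "{commutator D E |D E. D \<in> Der \<and> E \<in> Der} \<subseteq> L.span {?N}"
        using commutator_in_line by (fastforce simp: L.span_singleton)
      then show ?thesis by (simp add: L.span_minimal)
    qed
    moreover have "commutator D E = 0" if "D \<in> L.span {?N}" "E \<in> L.span {?N}" for D E
      using that N by (auto simp: L.span_singleton L.bracket_scale_left L.bracket_scale_right
          L.bracket_self L.subspace_scale[OF L.subspace_carrier])
    ultimately have "{commutator D E |D E. D \<in> L.derived_series 1 \<and> E \<in> L.derived_series 1} \<subseteq> {0}"
      by blast
    then have "L.derived_series (Suc 1) \<subseteq> L.span {0}"
      unfolding L.derived_series.simps by (rule L.span_mono)
    then have "L.derived_series (Suc 1) = {0}"
      by (auto simp: L.span_zero)
    then show ?thesis unfolding L.solvable_def by blast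
  qed
  ultimately show ?thesis using L.lie_algebra_axioms by blast
qed

end

lemma plane_of_basis:
  fixes scale :: "'k::field_char_0 \<Rightarrow> 'e::ab_group_add \<Rightarrow> 'e"
  assumes "vector_space scale" "v1 \<noteq> v2" "\<not> module.dependent scale {v1, v2}"
    and "module.span scale {v1, v2} = UNIV"
  shows "\<exists>c1 c2. plane scale v1 v2 c1 c2"
proof -
  interpret vector_space scale by (rule assms)
  let ?c = "\<lambda>v x. representation {v1, v2} x v"
  have "plane scale v1 v2 (?c v1) (?c v2)"
  proof unfold_locales
    fix x
    have "(\<Sum>b\<in>{v1, v2}. scale (?c b x) b) = x"
      by (rule sum_representation_eq) (use assms in auto)
    then show "scale (?c v1 x) v1 + scale (?c v2 x) v2 = x" using assms(2) by simp
  qed (use assms in \<open>auto simp: representation_add representation_scale representation_basis\<close>)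
  then show ?thesis by blast
qed

theorem theorem3:
  fixes scale :: "'k::field_char_0 \<Rightarrow> 'e::ab_group_add \<Rightarrow> 'e" and v1 v2 :: 'e
  assumes "vector_space scale"
    and "v1 \<noteq> v2"
    and "\<not> module.dependent scale {v1, v2}"
    and "module.span scale {v1, v2} = UNIV"
  defines "W_scale \<equiv> fun_scale (fun_scale scale)"
  defines "Der_scale \<equiv> fun_scale W_scale"
  defines "Der \<equiv> derivations W_scale (bilinear_maps scale) (W_mult v1)"
  shows "lie_algebra Der_scale Der commutator
    \<and> vector_space.dim Der_scale Der = 2
    \<and> lie_algebra.solvable Der_scale Der commutator"
proof -
  obtain c1 c2 where "plane scale v1 v2 c1 c2"
    using plane_of_basis[OF assms(1-4)] by blast
  then show ?thesis
    unfolding Der_def Der_scale_def W_scale_def by (rule plane.Der_dim_solvable)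
qed

end
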